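(* Let $C\subseteq\mathbb{R}^n$ be a nonempty convex compact set, let $f:C\times C\to\mathbb{R}$ satisfy $f(x,x)=0$ for all $x\in C$, and let $K:C\rightrightarrows C$ be a set-valued map. Define $F:C\rightrightarrows C$ by $F(x):=\{y\in C: f(x,y)<0\}$. Assume that $K$ is lower semicontinuous with nonempty convex values and that $\operatorname{fix}K$ is closed. Moreover suppose that (i) $F(x)$ is convex for every $x\in\operatorname{fix}K$; (ii) $F$ is lower semicontinuous on $\operatorname{fix}K$; (iii) $\operatorname{aff}K(x)=\operatorname{aff}C$ for all $x\in\partial_C\operatorname{fix}K$; (iv) $F(x)$ is open in $C$ for all $x\in\partial_C\operatorname{fix}K$. Then the quasiequilibrium problem has a solution, i.e. there exists $x\in C$ such that $x\in K(x)$ and $f(x,y)\ge 0$ for all $y\in K(x)$.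
   Context: A set-valued map $\Phi:X\rightrightarrows Y$ between topological spaces assigns to each $x\in X$ a (possibly empty) subset $\Phi(x)\subseteq Y$. It is lower semicontinuous at $x$ if for each open set $\Omega$ with $\Phi(x)\cap\Omega\neq\emptyset$ there is a neighborhood $U_x$ of $x$ such that $\Phi(x')\cap\Omega\neq\emptyset$ for all $x'\in U_x$; it is lower semicontinuous if it is so at every point. "Lower semicontinuous on $S$", for $S\subseteq X$, means that the restriction of the map to $S$ (with the relative topology on $S$) is lower semicontinuous. $\operatorname{fix}K:=\{x\in C: x\in K(x)\}$. For $A\subseteq C$, $\operatorname{int}_CA$ and $\operatorname{cl}_CA$ are the interior and closure of $A$ in the relative topology of $C$, and $\partial_CA:=\operatorname{cl}_CA\setminus\operatorname{int}_CA$. $\operatorname{aff}$ denotes the affine hull, the smallest affine subset of $\mathbb{R}^n$ containing the given set. *)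

theory Defs
  imports "HOL-Analysis.Analysis"
begin

(* Set-valued maps from X to Y are functions into sets; only their values on
   topspace X matter. Lower semicontinuity on a subset S of topspace X is
   lsc_map (subtopology X S) Y Phi. *)

definition lsc_map_at ::
    "'a topology \<Rightarrow> 'b topology \<Rightarrow> ('a \<Rightarrow> 'b set) \<Rightarrow> 'a \<Rightarrow> bool" where
  "lsc_map_at X Y \<Phi> x \<longleftrightarrow>
     (\<forall>W. openin Y W \<and> \<Phi> x \<inter> W \<noteq> {} \<longrightarrow>
        (\<exists>U. openin X U \<and> x \<in> U \<and> (\<forall>x'\<in>U. \<Phi> x' \<inter> W \<noteq> {})))"

definition lsc_map ::
    "'a topology \<Rightarrow> 'b topology \<Rightarrow> ('a \<Rightarrow> 'b set) \<Rightarrow> bool" where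
  "lsc_map X Y \<Phi> \<longleftrightarrow> (\<forall>x\<in>topspace X. lsc_map_at X Y \<Phi> x)"

definition fix_points :: "'a set \<Rightarrow> ('a \<Rightarrow> 'a set) \<Rightarrow> 'a set" where
  "fix_points C K = {x \<in> C. x \<in> K x}"

definition neg_map :: "'a set \<Rightarrow> ('a \<Rightarrow> 'a \<Rightarrow> real) \<Rightarrow> 'a \<Rightarrow> 'a set" where
  "neg_map C f x = {y \<in> C. f x y < 0}"

end

(* Suppose there is no solution. Let P = fix K and F = neg_map C f, and let G be K off P, the
   intersection of K and F on the relative boundary of P, and F on the relative interior of P.
   All values of G are then nonempty and convex, and G is lower semicontinuous: on the boundary,
   (iv) lets one approximate a point of K x and F x by one in F x and in the relative interior
   of K x, and by (iii) a whole relative neighbourhood in C of that point lies in the nearby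
   values of K. A fixed point x of G must be in P (off P, G x is K x) and then in F x, which
   contradicts f x x = 0. So G cannot have a fixed point. But Michael's selection theorem, in
   its finite-dimensional form for values that need not be closed, yields a continuous
   selection of G, and Brouwer's theorem a fixed point of it. *)
theory Submission
  imports Defs
begin

section \<open>Lower semicontinuity and change of topology\<close>

lemma lsc_map_iff_openin:
  "lsc_map X Y G \<longleftrightarrow> (\<forall>W. openin Y W \<longrightarrow> openin X {x \<in> topspace X. G x \<inter> W \<noteq> {}})"
    (is "?L \<longleftrightarrow> ?R")
proof
  assume L: ?L
  show ?R
  proof (intro allI impI)
    fix W assume W: "openin Y W"
    show "openin X {x \<in> topspace X. G x \<inter> W \<noteq> {}}"
    proof (subst openin_subopen, intro ballI)
      fix x assume "x \<in> {x \<in> topspace X. G x \<inter> W \<noteq> {}}"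
      then obtain U where U: "openin X U" "x \<in> U" "\<forall>x'\<in>U. G x' \<inter> W \<noteq> {}"
        using L W unfolding lsc_map_def lsc_map_at_def by blast
      then show "\<exists>T. openin X T \<and> x \<in> T \<and> T \<subseteq> {x \<in> topspace X. G x \<inter> W \<noteq> {}}"
        using openin_subset[OF U(1)] by (intro exI[of _ U]) auto
    qed
  qed
next
  assume R: ?R
  show ?L
    unfolding lsc_map_def lsc_map_at_def
  proof (intro ballI allI impI)
    fix x W assume "x \<in> topspace X" "openin Y W \<and> G x \<inter> W \<noteq> {}"
    then show "\<exists>U. openin X U \<and> x \<in> U \<and> (\<forall>x'\<in>U. G x' \<inter> W \<noteq> {})"
      using R by (intro exI[of _ "{x \<in> topspace X. G x \<inter> W \<noteq> {}}"]) auto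
  qed
qed

text \<open>The data are semicontinuous for the relative topology of \<open>C\<close>; in the
  ambient topology, balls of the whole space can serve as test sets.\<close>

lemma lsc_map_into_euclidean:
  assumes "lsc_map X (top_of_set S) G" and "\<And>x. x \<in> topspace X \<Longrightarrow> G x \<subseteq> S"
  shows "lsc_map X euclidean G"
  unfolding lsc_map_iff_openin
proof (intro allI impI)
  fix W :: "'b set" assume "openin euclidean W"
  then have "openin (top_of_set S) (S \<inter> W)"
    by (simp add: openin_open_Int)
  then have "openin X {x \<in> topspace X. G x \<inter> (S \<inter> W) \<noteq> {}}"
    using assms(1) unfolding lsc_map_iff_openin by blast
  moreover have "{x \<in> topspace X. G x \<inter> (S \<inter> W) \<noteq> {}} = {x \<in> topspace X. G x \<inter> W \<noteq> {}}"
    using assms(2) by blast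
  ultimately show "openin X {x \<in> topspace X. G x \<inter> W \<noteq> {}}" by simp
qed

section \<open>Approximate selections and selections of the closures\<close>

text \<open>The set is the Minkowski sum of \<open>A\<close> and a ball about 0. Averages of points
  close to a convex value therefore stay close to it.\<close>

lemma convex_thickening:
  fixes A :: "'a::real_normed_vector set"
  assumes "convex A"
  shows "convex {q. \<exists>y\<in>A. dist q y < e}"
proof -
  have "{q. \<exists>y\<in>A. dist q y < e} = (\<Union>x\<in>A. \<Union>y\<in>ball 0 e. {x + y})"
  proof (intro equalityI subsetI)
    fix q assume "q \<in> {q. \<exists>y\<in>A. dist q y < e}"
    then obtain y where "y \<in> A" "q - y \<in> ball 0 e" by (auto simp: dist_norm norm_minus_commute)
    then show "q \<in> (\<Union>x\<in>A. \<Union>y\<in>ball 0 e. {x + y})" by force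
  qed (force simp: dist_norm)
  then show ?thesis
    using convex_sums[OF assms convex_ball[of 0 e]] by simp
qed

text \<open>By lower semicontinuity, a point chosen in \<open>G x\<close> is still within
  \<open>e\<close> of \<open>G x'\<close> for \<open>x'\<close> near \<open>x\<close>. Finitely many
  such choices are averaged by a partition of unity, and convexity keeps the average within
  \<open>e\<close> of every value.\<close>

lemma lsc_map_approx_selection:
  fixes G :: "'a::metric_space \<Rightarrow> 'b::real_normed_vector set"
  assumes X: "compact X" and lsc: "lsc_map (top_of_set X) euclidean G"
    and G: "\<And>x. x \<in> X \<Longrightarrow> G x \<noteq> {} \<and> convex (G x)" and e: "e > 0"
  obtains g where "continuous_on X g" "\<And>x. x \<in> X \<Longrightarrow> \<exists>y\<in>G x. dist (g x) y < e"
proof -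
  have "\<exists>p d. d > 0 \<and> (\<forall>x'\<in>X. dist x' x < d \<longrightarrow> (\<exists>y\<in>G x'. dist p y < e))" if x: "x \<in> X" for x
  proof -
    obtain p where p: "p \<in> G x" using G x by blast
    have "openin (top_of_set X) {x'\<in>X. G x' \<inter> ball p e \<noteq> {}}"
      using lsc unfolding lsc_map_iff_openin by simp
    moreover have "x \<in> {x'\<in>X. G x' \<inter> ball p e \<noteq> {}}"
      using p x e by auto
    ultimately obtain d where "d > 0" "ball x d \<inter> X \<subseteq> {x'\<in>X. G x' \<inter> ball p e \<noteq> {}}"
      unfolding openin_contains_ball by blast
    then show ?thesis
      by (intro exI[of _ p] exI[of _ d]) (force simp: dist_commute)
  qed
  then obtain p d where d: "\<And>x. x \<in> X \<Longrightarrow> d x > 0"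
    and p: "\<And>x x'. \<lbrakk>x \<in> X; x' \<in> X; dist x' x < d x\<rbrakk> \<Longrightarrow> \<exists>y\<in>G x'. dist (p x) y < e"
    by metis
  \<comment> \<open>The partition of unity is built from tent functions on balls, because distances to
    complements of cover members have the junk value 0 when such a complement is empty.\<close>
  have "X \<subseteq> (\<Union>c\<in>X. ball c (d c))" using d by force
  then obtain D where D: "D \<subseteq> X" "finite D" "X \<subseteq> (\<Union>c\<in>D. ball c (d c))"
    using compactE_image[OF X, of X "\<lambda>c. ball c (d c)"] by auto
  define w where "w c x = max 0 (d c - dist x c)" for c x
  define s where "s x = (\<Sum>c\<in>D. w c x)" for x
  define g where "g x = (\<Sum>c\<in>D. (w c x / s x) *\<^sub>R p c)" for x
  have w0: "w c x \<ge> 0" for c x by (simp add: w_def)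
  have s0: "s x > 0" if x: "x \<in> X" for x
  proof -
    obtain c where "c \<in> D" "dist c x < d c" using D x by auto
    then show ?thesis
      unfolding s_def using D(2) w0
      by (intro sum_pos2[of D c]) (auto simp: w_def dist_commute)
  qed
  have "continuous_on X g"
    unfolding g_def using s0 unfolding s_def w_def
    by (intro continuous_intros) (auto simp: less_imp_neq[THEN not_sym])
  moreover have "\<exists>y\<in>G x. dist (g x) y < e" if x: "x \<in> X" for x
  proof -
    define T where "T = {q. \<exists>y\<in>G x. dist q y < e}"
    \<comment> \<open>Centres of weight 0 must be dropped: their \<open>p c\<close> may lie far from
      \<open>G x\<close>.\<close>
    define D' where "D' = {c\<in>D. w c x > 0}"
    have sub: "D' \<subseteq> D" "finite D'" using D by (auto simp: D'_def)
    have z: "w c x = 0" if "c \<in> D - D'" for c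
      using that w0[of c x] by (auto simp: D'_def)
    have "(\<Sum>c\<in>D'. w c x) = s x"
      unfolding s_def using z sub D(2) by (intro sum.mono_neutral_left) auto
    then have "(\<Sum>c\<in>D'. w c x / s x) = 1"
      using s0[OF x] by (simp flip: sum_divide_distrib)
    moreover have "p c \<in> T" if "c \<in> D'" for c
      using that D(1) p[of c x] x by (auto simp: T_def D'_def w_def max_def split: if_splits)
    ultimately have "(\<Sum>c\<in>D'. (w c x / s x) *\<^sub>R p c) \<in> T"
      using convex_thickening G[OF x] w0 s0[OF x] sub
      by (intro convex_sum) (auto simp: T_def less_imp_le)
    moreover have "(\<Sum>c\<in>D'. (w c x / s x) *\<^sub>R p c) = g x"
      unfolding g_def using z sub D(2) by (intro sum.mono_neutral_left) auto
    ultimately show ?thesis by (simp add: T_def)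
  qed
  ultimately show thesis using that by blast
qed

text \<open>The ball is open and its centre moves continuously, so a point inside it leaves some
  slack. This lets each approximate selection be chosen near the previous one.\<close>

lemma lsc_map_Int_ball:
  fixes G :: "'a::metric_space \<Rightarrow> 'b::metric_space set"
  assumes lsc: "lsc_map (top_of_set X) euclidean G" and g: "continuous_on X g"
  shows "lsc_map (top_of_set X) euclidean (\<lambda>x. G x \<inter> ball (g x) e)"
  unfolding lsc_map_def lsc_map_at_def
proof (intro ballI allI impI)
  fix x W
  assume "x \<in> topspace (top_of_set X)" and "openin euclidean W \<and> G x \<inter> ball (g x) e \<inter> W \<noteq> {}"
  then obtain y where x: "x \<in> X" and W: "open W" and y: "y \<in> G x" "dist (g x) y < e" "y \<in> W"
    by auto
  \<comment> \<open>Half of the slack is for the motion of the centre, half for the motion of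
    \<open>y\<close>.\<close>
  define d where "d = (e - dist (g x) y) / 2"
  have d: "d > 0" using y by (simp add: d_def)
  define U where "U = {x'\<in>X. G x' \<inter> (W \<inter> ball y d) \<noteq> {}} \<inter> (X \<inter> g -` ball (g x) d)"
  have "openin (top_of_set X) {x'\<in>X. G x' \<inter> (W \<inter> ball y d) \<noteq> {}}"
    using lsc W unfolding lsc_map_iff_openin by (simp add: open_Int)
  then have "openin (top_of_set X) U"
    unfolding U_def using g by (intro openin_Int continuous_openin_preimage_gen) auto
  moreover have "x \<in> U" using x y d by (auto simp: U_def)
  moreover have "G x' \<inter> ball (g x') e \<inter> W \<noteq> {}" if x': "x' \<in> U" for x'
  proof -
    obtain y' where y': "y' \<in> G x'" "y' \<in> W" "dist y y' < d"
      using x' unfolding U_def by auto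
    have "dist (g x) (g x') < d"
      using x' unfolding U_def by auto
    then have "dist (g x') y' < d + dist (g x) y + d"
      using y' dist_triangle[of "g x'" y' "g x"] dist_triangle[of "g x" y' y] by (simp add: dist_commute)
    then have "dist (g x') y' < e" by (simp add: d_def)
    with y' show ?thesis by auto
  qed
  ultimately show "\<exists>U. openin (top_of_set X) U \<and> x \<in> U \<and> (\<forall>x'\<in>U. G x' \<inter> ball (g x') e \<inter> W \<noteq> {})"
    by blast
qed

text \<open>Approximations of accuracy \<open>(1/2)^n\<close>, each built near the previous one,
  converge uniformly. The values need not be closed, so the limit is only placed in their
  closures.\<close>

lemma lsc_map_closure_selection:
  fixes G :: "'a::metric_space \<Rightarrow> 'b::banach set"
  assumes X: "compact X" and lsc: "lsc_map (top_of_set X) euclidean G"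
    and G: "\<And>x. x \<in> X \<Longrightarrow> G x \<noteq> {} \<and> convex (G x)"
  obtains g where "continuous_on X g" "\<And>x. x \<in> X \<Longrightarrow> g x \<in> closure (G x)"
proof -
  define P where "P n g \<longleftrightarrow> continuous_on X g \<and> (\<forall>x\<in>X. \<exists>y\<in>G x. dist (g x) y < (1/2)^n)"
    for n :: nat and g
  have "\<exists>g. P 0 g"
    using lsc_map_approx_selection[OF X lsc G, of 1] by (metis P_def power_0 zero_less_one)
  \<comment> \<open>The bound is the radius of the ball about \<open>g x\<close> plus the new
    accuracy, rounded up.\<close>
  moreover have "\<exists>g'. P (Suc n) g' \<and> (\<forall>x\<in>X. dist (g x) (g' x) < 2 * (1/2)^n)" if g: "P n g" for g n
  proof -
    have "lsc_map (top_of_set X) euclidean (\<lambda>x. G x \<inter> ball (g x) ((1/2)^n))"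
      using lsc g by (intro lsc_map_Int_ball) (auto simp: P_def)
    moreover have "G x \<inter> ball (g x) ((1/2)^n) \<noteq> {} \<and> convex (G x \<inter> ball (g x) ((1/2)^n))" if "x \<in> X" for x
      using g G that by (force simp: P_def intro: convex_Int)
    ultimately obtain g' where g': "continuous_on X g'"
      "\<And>x. x \<in> X \<Longrightarrow> \<exists>y\<in>G x \<inter> ball (g x) ((1/2)^n). dist (g' x) y < (1/2)^Suc n"
      using lsc_map_approx_selection[OF X, of _ "(1/2)^Suc n"]
      by (metis (no_types, lifting) half_gt_zero_iff zero_less_one zero_less_power)
    have "dist (g x) (g' x) < 2 * (1/2)^n" if "x \<in> X" for x
    proof -
      obtain y where "dist (g x) y < (1/2)^n" "dist (g' x) y < (1/2)^Suc n"
        using g'(2)[OF \<open>x \<in> X\<close>] by auto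
      moreover have "(1/2::real)^Suc n \<le> (1/2)^n" by simp
      ultimately show ?thesis
        using dist_triangle2[of "g x" "g' x" y] by linarith
    qed
    with g' show ?thesis unfolding P_def by blast
  qed
  ultimately obtain g where g: "\<And>n. P n (g n)"
    and step: "\<And>n x. x \<in> X \<Longrightarrow> dist (g n x) (g (Suc n) x) < 2 * (1/2)^n"
    using dependent_nat_choice[of P "\<lambda>n g g'. \<forall>x\<in>X. dist (g x) (g' x) < 2 * (1/2)^n"] by metis
  have "uniform_limit X (\<lambda>n x. \<Sum>i<n. g (Suc i) x - g i x)
      (\<lambda>x. \<Sum>i. g (Suc i) x - g i x) sequentially"
  proof (rule Weierstrass_m_test)
    show "norm (g (Suc n) x - g n x) \<le> 2 * (1/2)^n" if "x \<in> X" for n x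
      using step[OF that, of n] by (simp add: dist_norm norm_minus_commute)
    show "summable (\<lambda>n. 2 * (1/2::real)^n)" by (intro summable_mult) simp
  qed
  then have lim: "uniform_limit X (\<lambda>n x. g n x - g 0 x) (\<lambda>x. \<Sum>i. g (Suc i) x - g i x) sequentially"
    using sum_lessThan_telescope[of "\<lambda>i. g i x" for x] by simp
  define h where "h = (\<lambda>x. (\<Sum>i. g (Suc i) x - g i x) + g 0 x)"
  have lim: "uniform_limit X g h sequentially"
  proof -
    have "uniform_limit X (\<lambda>n. g 0) (g 0) sequentially" by (simp add: uniform_limit_iff)
    from uniform_limit_add[OF lim this] show ?thesis by (simp add: h_def)
  qed
  have "continuous_on X h"
    using g by (intro uniform_limit_theorem[OF _ lim]) (auto simp: P_def)
  moreover have "h x \<in> closure (G x)" if x: "x \<in> X" for x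
    unfolding closure_approachable
  proof (intro allI impI)
    fix e :: real assume e: "e > 0"
    have "(\<lambda>n. g n x) \<longlonglongrightarrow> h x"
      using tendsto_uniform_limitI[OF lim x] .
    then have "\<forall>\<^sub>F n in sequentially. dist (g n x) (h x) < e/2"
      using e by (intro tendstoD) auto
    moreover have "\<forall>\<^sub>F n in sequentially. (1/2::real)^n < e/2"
      using e by (intro order_tendstoD[OF LIMSEQ_power_zero]) auto
    ultimately obtain n where n: "dist (g n x) (h x) < e/2" "(1/2)^n < e/2"
      using eventually_happens'[OF sequentially_bot eventually_conj] by blast
    obtain y where "y \<in> G x" "dist (g n x) y < (1/2)^n"
      using g[of n] x unfolding P_def by blast
    moreover have "dist y (h x) \<le> dist (g n x) y + dist (g n x) (h x)"
      using dist_triangle3 by blast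
    ultimately show "\<exists>y\<in>G x. dist y (h x) < e"
      using n by (intro bexI[of _ y]) auto
  qed
  ultimately show thesis using that by blast
qed

section \<open>Dense families of selections and a selection from the relative interiors\<close>

text \<open>Shrinking \<open>G\<close> to its part in \<open>B\<close> over \<open>A\<close> keeps
  it lower semicontinuous, because \<open>B\<close> and the complement of \<open>A\<close> are open.
  Any selection of the closures of the shrunken map will do.\<close>

lemma lsc_map_closure_selection_on_closed:
  fixes G :: "'a::metric_space \<Rightarrow> 'b::banach set"
  assumes X: "compact X" and lsc: "lsc_map (top_of_set X) euclidean G"
    and G: "\<And>x. x \<in> X \<Longrightarrow> G x \<noteq> {} \<and> convex (G x)"
    and A: "closed A" and B: "open B" "convex B"
    and AB: "\<And>x. x \<in> X \<inter> A \<Longrightarrow> G x \<inter> B \<noteq> {}"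
  obtains g where "continuous_on X g" "\<And>x. x \<in> X \<Longrightarrow> g x \<in> closure (G x)"
    "\<And>x. x \<in> X \<inter> A \<Longrightarrow> g x \<in> closure B"
proof -
  define H where "H x = (if x \<in> A then G x \<inter> B else G x)" for x
  have "lsc_map (top_of_set X) euclidean H"
    unfolding lsc_map_iff_openin
  proof (intro allI impI)
    fix W :: "'b set" assume W: "openin euclidean W"
    \<comment> \<open>Near a point of \<open>A\<close>, meeting \<open>B\<close> and
      \<open>W\<close> at once suffices, whether or not the nearby points lie in
      \<open>A\<close>.\<close>
    have "openin (top_of_set X) {x\<in>X. G x \<inter> (B \<inter> W) \<noteq> {}}" "openin (top_of_set X) {x\<in>X. G x \<inter> W \<noteq> {}}"
      using lsc B W unfolding lsc_map_iff_openin by (simp_all add: open_Int)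
    moreover have "openin (top_of_set X) (X \<inter> - A)"
      using A by (simp add: openin_open_Int open_Compl)
    ultimately have "openin (top_of_set X)
        ({x\<in>X. G x \<inter> (B \<inter> W) \<noteq> {}} \<union> {x\<in>X. G x \<inter> W \<noteq> {}} \<inter> (X \<inter> - A))"
      by blast
    moreover have "{x\<in>X. G x \<inter> (B \<inter> W) \<noteq> {}} \<union> {x\<in>X. G x \<inter> W \<noteq> {}} \<inter> (X \<inter> - A) = {x\<in>X. H x \<inter> W \<noteq> {}}"
      by (auto simp: H_def)
    ultimately show "openin (top_of_set X) {x\<in>topspace (top_of_set X). H x \<inter> W \<noteq> {}}"
      by simp
  qed
  moreover have "H x \<noteq> {} \<and> convex (H x)" if "x \<in> X" for x
    using G[OF that] AB[of x] that B by (auto simp: H_def convex_Int)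
  ultimately obtain g where g: "continuous_on X g" "\<And>x. x \<in> X \<Longrightarrow> g x \<in> closure (H x)"
    using lsc_map_closure_selection[OF X] by blast
  have "H x \<subseteq> G x" for x by (auto simp: H_def)
  moreover have "H x \<subseteq> B" if "x \<in> A" for x using that by (auto simp: H_def)
  ultimately show thesis
    using that[of g] g by (metis IntE closure_mono subsetD)
qed

text \<open>
  For each pair of balls, one in the domain and one in the range, there is a selection that takes
  values in the closed second ball over the first, whenever the values of G meet the second ball there.
\<close>
lemma lsc_map_dense_selections:
  fixes G :: "'a::{metric_space, second_countable_topology} \<Rightarrow> 'b::{banach, second_countable_topology} set"
  assumes X: "compact X" and lsc: "lsc_map (top_of_set X) euclidean G"
    and G: "\<And>x. x \<in> X \<Longrightarrow> G x \<noteq> {} \<and> convex (G x)"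
  obtains f :: "nat \<Rightarrow> 'a \<Rightarrow> 'b" where "\<And>i. continuous_on X (f i)"
    "\<And>i x. x \<in> X \<Longrightarrow> f i x \<in> closure (G x)"
    "\<And>x. x \<in> X \<Longrightarrow> G x \<subseteq> closure (range (\<lambda>i. f i x))"
proof -
  obtain D :: "'a set" where D: "countable D" "\<And>U. \<lbrakk>open U; U \<noteq> {}\<rbrakk> \<Longrightarrow> \<exists>d\<in>D. d \<in> U"
    by (erule countable_dense_setE)
  obtain E :: "'b set" where E: "countable E" "\<And>U. \<lbrakk>open U; U \<noteq> {}\<rbrakk> \<Longrightarrow> \<exists>d\<in>E. d \<in> U"
    by (erule countable_dense_setE)
  define r where "r n = inverse (real (Suc n))" for n
  have r: "r n > 0" for n by (simp add: r_def)
  have r_small: "\<exists>n. 2 * r n < e" if e: "e > 0" for e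
  proof -
    obtain n where "inverse (real (Suc n)) < e/2" using reals_Archimedean[of "e/2"] e by auto
    then show ?thesis by (intro exI[of _ n]) (simp add: r_def)
  qed
  define J where "J = D \<times> (UNIV :: nat set) \<times> E \<times> (UNIV :: nat set)"
  have J: "countable J" "J \<noteq> {}"
    using D E D(2)[of UNIV] E(2)[of UNIV] by (auto simp: J_def)
  \<comment> \<open>The ball in the domain is closed so that values over it may be prescribed. Where
    \<open>ok\<close> fails, an arbitrary selection fills the slot.\<close>
  define ok where "ok p n q m \<longleftrightarrow> (\<forall>x\<in>X \<inter> cball p (r n). G x \<inter> ball q (r m) \<noteq> {})" for p n q m
  have "\<exists>h. continuous_on X h \<and> (\<forall>x\<in>X. h x \<in> closure (G x)) \<and>
      (ok p n q m \<longrightarrow> (\<forall>x\<in>X \<inter> cball p (r n). dist (h x) q \<le> r m))" for p n q m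
  proof (cases "ok p n q m")
    case True
    then obtain h where "continuous_on X h" "\<And>x. x \<in> X \<Longrightarrow> h x \<in> closure (G x)"
      "\<And>x. x \<in> X \<inter> cball p (r n) \<Longrightarrow> h x \<in> closure (ball q (r m))"
      using lsc_map_closure_selection_on_closed[OF X lsc G, of "cball p (r n)" "ball q (r m)"]
      unfolding ok_def by (metis closed_cball convex_ball open_ball)
    then show ?thesis using r by (intro exI[of _ h]) (auto simp: dist_commute)
  next
    case False
    obtain h where "continuous_on X h" "\<And>x. x \<in> X \<Longrightarrow> h x \<in> closure (G x)"
      using lsc_map_closure_selection[OF X lsc G] by metis
    with False show ?thesis by blast
  qed
  then obtain h where h: "\<And>p n q m. continuous_on X (h p n q m)"
     "\<And>p n q m x. x \<in> X \<Longrightarrow> h p n q m x \<in> closure (G x)"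
     "\<And>p n q m x. \<lbrakk>ok p n q m; x \<in> X; x \<in> cball p (r n)\<rbrakk> \<Longrightarrow> dist (h p n q m x) q \<le> r m"
    by (metis IntI)
  define f where "f i = (case from_nat_into J i of (p, n, q, m) \<Rightarrow> h p n q m)" for i
  show thesis
  proof
    show "continuous_on X (f i)" for i using h by (auto simp: f_def split: prod.splits)
    show "f i x \<in> closure (G x)" if "x \<in> X" for i x using h that by (auto simp: f_def split: prod.splits)
    show "G x \<subseteq> closure (range (\<lambda>i. f i x))" if x: "x \<in> X" for x
    proof
      fix y assume y: "y \<in> G x"
      show "y \<in> closure (range (\<lambda>i. f i x))"
        unfolding closure_approachable
      proof (intro allI impI)
        fix e :: real assume "e > 0"
        \<comment> \<open>One \<open>r m\<close> for the distance from \<open>y\<close> to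
          \<open>q\<close>, one for that from \<open>q\<close> to the selection.\<close>
        then obtain m where m: "2 * r m < e" using r_small by blast
        obtain q where q: "q \<in> E" "dist y q < r m"
          using E(2)[of "ball y (r m)"] r[of m] by auto
        have "openin (top_of_set X) {x'\<in>X. G x' \<inter> ball q (r m) \<noteq> {}}"
          using lsc unfolding lsc_map_iff_openin by simp
        moreover have "x \<in> {x'\<in>X. G x' \<inter> ball q (r m) \<noteq> {}}"
          using y x q by (auto simp: dist_commute)
        ultimately obtain d where d: "d > 0" "ball x d \<inter> X \<subseteq> {x'\<in>X. G x' \<inter> ball q (r m) \<noteq> {}}"
          unfolding openin_contains_ball by blast
        obtain n where n: "2 * r n < d" using r_small d by blast
        obtain p where p: "p \<in> D" "dist x p < r n"
          using D(2)[of "ball x (r n)"] r[of n] by auto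
        have "cball p (r n) \<subseteq> ball x d"
        proof
          fix z assume "z \<in> cball p (r n)"
          then show "z \<in> ball x d" using p n dist_triangle[of x z p] by simp
        qed
        then have "ok p n q m" using d by (auto simp: ok_def)
        then have hq: "dist (h p n q m x) q \<le> r m" using h x p by (simp add: dist_commute)
        have "(p, n, q, m) \<in> J" using p q by (simp add: J_def)
        then obtain i where "from_nat_into J i = (p, n, q, m)"
          using J from_nat_into_surj by metis
        then have "f i x = h p n q m x" by (simp add: f_def)
        then have "dist (f i x) y < e"
          using hq q m dist_triangle2[of "f i x" y q] by simp
        then show "\<exists>y'\<in>range (\<lambda>i. f i x). dist y' y < e" by blast
      qed
    qed
  qed
qed

text \<open>A hyperplane supporting S at g would have to contain every term of the series, hence all of S.\<close>
lemma weighted_series_in_rel_interior: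
  fixes S :: "'a::euclidean_space set"
  assumes S: "convex S" "S \<noteq> {}" and u: "\<And>i. u i \<in> closure S" and dense: "S \<subseteq> closure (range u)"
    and sums: "(\<lambda>i. (1/2)^Suc i *\<^sub>R u i) sums g"
  shows "g \<in> rel_interior S"
proof (rule ccontr)
  assume contra: "g \<notin> rel_interior S"
  \<comment> \<open>Cutting the series after \<open>n\<close> terms leaves the weight
    \<open>(1/2)^n\<close>. Given to \<open>u 0\<close>, it makes a convex combination with the same
    limit \<open>g\<close>.\<close>
  have half: "(\<Sum>i<n. (1/2)^Suc i) + (1/2)^n = (1::real)" for n
    by (induction n) (auto simp: field_simps)
  have "g \<in> closure S"
  proof (rule Lim_in_closed_set[OF closed_closure])
    have "(\<lambda>n. (\<Sum>i<n. (1/2)^Suc i *\<^sub>R u i) + (1/2)^n *\<^sub>R u 0) \<longlonglongrightarrow> g + 0 *\<^sub>R u 0"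
      using sums unfolding sums_def by (intro tendsto_intros LIMSEQ_power_zero) auto
    then show "(\<lambda>n. (\<Sum>i<n. (1/2)^Suc i *\<^sub>R u i) + (1/2)^n *\<^sub>R u 0) \<longlonglongrightarrow> g" by simp
    have "(\<Sum>i<n. (1/2)^Suc i *\<^sub>R u i) + (1/2)^n *\<^sub>R u 0 \<in> closure S" for n
    proof -
      have "(\<Sum>i\<in>{..n}. (if i < n then (1/2)^Suc i else (1/2)^n) *\<^sub>R (if i < n then u i else u 0)) \<in> closure S"
        using S u half[of n] by (intro convex_sum) (auto simp flip: lessThan_Suc_atMost)
      then show ?thesis by (simp flip: lessThan_Suc_atMost)
    qed
    then show "\<forall>\<^sub>F n in sequentially. (\<Sum>i<n. (1/2)^Suc i *\<^sub>R u i) + (1/2)^n *\<^sub>R u 0 \<in> closure S"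
      by simp
  qed simp
  then obtain a where a: "\<And>y. y \<in> closure S \<Longrightarrow> a \<bullet> g \<le> a \<bullet> y"
    and a': "\<And>y. y \<in> rel_interior S \<Longrightarrow> a \<bullet> g < a \<bullet> y"
    using supporting_hyperplane_relative_frontier[OF S(1) _ contra] by metis
  obtain y where y: "y \<in> rel_interior S" using S rel_interior_eq_empty by blast
  have "open {z. a \<bullet> g < a \<bullet> z}" by (simp add: open_halfspace_gt)
  moreover have "y \<in> closure (range u)" using y dense rel_interior_subset by blast
  moreover have "y \<in> {z. a \<bullet> g < a \<bullet> z}" using a'[OF y] by simp
  ultimately obtain k where k: "a \<bullet> g < a \<bullet> u k"
    unfolding closure_iff_nhds_not_empty by blast
  have "(\<lambda>i. a \<bullet> ((1/2)^Suc i *\<^sub>R u i)) sums (a \<bullet> g)"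
    using bounded_linear.sums[OF bounded_linear_inner_right sums] .
  moreover have "(\<lambda>i. (1/2)^Suc i * (a \<bullet> g)) sums (1 * (a \<bullet> g))"
    using power_half_series by (rule sums_mult2)
  ultimately have s: "(\<lambda>i. a \<bullet> ((1/2)^Suc i *\<^sub>R u i) - (1/2)^Suc i * (a \<bullet> g)) sums (a \<bullet> g - 1 * (a \<bullet> g))"
    by (rule sums_diff)
  then have s: "(\<lambda>i. (1/2)^Suc i * (a \<bullet> u i - a \<bullet> g)) sums 0"
    by (simp add: right_diff_distrib del: power_Suc)
  \<comment> \<open>The weighted excesses over the hyperplane are nonnegative and the
    \<open>k\<close>-th is positive, yet they sum to 0.\<close>
  have "0 < (\<Sum>i. (1/2)^Suc i * (a \<bullet> u i - a \<bullet> g))"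
    using s a[OF u] k by (intro suminf_pos2[of _ k]) (auto simp: sums_iff)
  then show False using s by (simp add: sums_iff)
qed

text \<open>Selecting from the relative interior is what makes Michael's theorem work without closed values.\<close>
lemma lsc_map_rel_interior_selection:
  fixes G :: "'a::{metric_space, second_countable_topology} \<Rightarrow> 'b::euclidean_space set"
  assumes X: "compact X" and lsc: "lsc_map (top_of_set X) euclidean G"
    and G: "\<And>x. x \<in> X \<Longrightarrow> G x \<noteq> {} \<and> convex (G x)"
    and bdd: "bounded (\<Union>x\<in>X. G x)"
  obtains g where "continuous_on X g" "\<And>x. x \<in> X \<Longrightarrow> g x \<in> rel_interior (G x)"
proof -
  obtain f :: "nat \<Rightarrow> 'a \<Rightarrow> 'b" where f: "\<And>i. continuous_on X (f i)"
    "\<And>i x. x \<in> X \<Longrightarrow> f i x \<in> closure (G x)"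
    "\<And>x. x \<in> X \<Longrightarrow> G x \<subseteq> closure (range (\<lambda>i. f i x))"
    using lsc_map_dense_selections[OF X lsc G] by metis
  \<comment> \<open>The bound is taken on the closure because each \<open>f i\<close> selects only
    from \<open>closure (G x)\<close>.\<close>
  obtain M where M: "\<And>y. y \<in> closure (\<Union>x\<in>X. G x) \<Longrightarrow> norm y \<le> M"
    using bdd bounded_closure bounded_iff by metis
  have fM: "norm (f i x) \<le> M" if "x \<in> X" for i x
    using M f(2)[OF that] closure_mono[of "G x" "\<Union>x\<in>X. G x"] that by blast
  define g where "g x = (\<Sum>i. (1/2)^Suc i *\<^sub>R f i x)" for x
  have bound: "norm ((1/2)^Suc i *\<^sub>R f i x) \<le> (1/2)^Suc i * M" if "x \<in> X" for i x
    using fM[OF that] by (simp add: field_simps)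
  have summ: "summable (\<lambda>i. (1/2::real)^Suc i * M)"
    using power_half_series by (intro summable_mult2) (rule sums_summable)
  have lim: "uniform_limit X (\<lambda>n x. \<Sum>i<n. (1/2)^Suc i *\<^sub>R f i x) g sequentially"
    unfolding g_def using bound summ by (rule Weierstrass_m_test)
  have "continuous_on X g"
    by (rule uniform_limit_theorem[OF _ lim]) (intro always_eventually allI continuous_intros f(1), simp)
  moreover have "g x \<in> rel_interior (G x)" if x: "x \<in> X" for x
  proof (rule weighted_series_in_rel_interior)
    show "(\<lambda>i. (1/2)^Suc i *\<^sub>R f i x) sums g x"
      unfolding g_def using summable_comparison_test'[OF summ bound[OF x]] by (rule summable_sums)
  qed (use G f x in auto)
  ultimately show thesis using that by blast
qed

section \<open>Relative balls inside nearby convex values\<close>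

text \<open>Lower semicontinuity only makes nearby values meet given open sets. For convex values in
  a fixed affine set, meeting finitely many small balls already forces them to contain a relative
  ball.\<close>

lemma lsc_map_locally_contains_cball:
  fixes K :: "'a \<Rightarrow> 'b::euclidean_space set"
  assumes lsc: "lsc_map X euclidean K" and K: "\<And>x'. x' \<in> topspace X \<Longrightarrow> convex (K x') \<and> K x' \<subseteq> S"
    and S: "affine S" and x: "x \<in> topspace X" and y: "y \<in> S" and r: "r > 0" "cball y r \<inter> S \<subseteq> K x"
  obtains U where "openin X U" "x \<in> U" "\<And>x'. x' \<in> U \<Longrightarrow> cball y (r/2) \<inter> S \<subseteq> K x'"
proof -
  have "compact (cball y r \<inter> S)"
    using S by (simp add: affine_closed compact_Int_closed)
  moreover have "cball y r \<inter> S \<subseteq> (\<Union>v\<in>cball y r \<inter> S. ball v (r/4))" using r by force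
  ultimately obtain D where D: "D \<subseteq> cball y r \<inter> S" "finite D" "cball y r \<inter> S \<subseteq> (\<Union>v\<in>D. ball v (r/4))"
    using compactE_image[of "cball y r \<inter> S" "cball y r \<inter> S" "\<lambda>v. ball v (r/4)"] by auto
  have "D \<noteq> {}" using D y r by force
  \<comment> \<open>D is an r/4-net of the ball; choosing a point of K x' near each net point and taking the convex
    hull covers the half-size ball, since otherwise a separating hyperplane would miss a net point.\<close>
  define U where "U = (\<Inter>v\<in>D. {x'\<in>topspace X. K x' \<inter> ball v (r/4) \<noteq> {}})"
  show thesis
  proof
    show "openin X U"
      unfolding U_def using D(2) \<open>D \<noteq> {}\<close> lsc unfolding lsc_map_iff_openin
      by (intro openin_INT2) auto
    show "x \<in> U"
      unfolding U_def using x D(1) r by force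
    show "cball y (r/2) \<inter> S \<subseteq> K x'" if x': "x' \<in> U" for x'
    proof
      fix z assume z: "z \<in> cball y (r/2) \<inter> S"
      have top: "x' \<in> topspace X" using x' \<open>D \<noteq> {}\<close> by (auto simp: U_def)
      obtain v' where v': "\<And>v. v \<in> D \<Longrightarrow> v' v \<in> K x' \<and> dist v (v' v) < r/4"
      proof -
        have "\<exists>w. w \<in> K x' \<and> dist v w < r/4" if "v \<in> D" for v
          using x' that by (auto simp: U_def)
        then show thesis using that by metis
      qed
      have hull: "convex hull (v' ` D) \<subseteq> K x'"
        using v' K[OF top] by (intro hull_minimal) auto
      have "z \<in> convex hull (v' ` D)"
      proof (rule ccontr)
        assume "z \<notin> convex hull (v' ` D)"
        moreover have "closed (convex hull (v' ` D))"
          using D(2) by (simp add: compact_imp_closed finite_imp_compact_convex_hull)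
        \<comment> \<open>This form of separation has the normal \<open>a - z\<close>, a difference
          of two points of \<open>S\<close>, so moving along it does not leave
          \<open>S\<close>.\<close>
        ultimately obtain a b where a: "a \<in> convex hull (v' ` D)" "(a - z) \<bullet> z < b"
          "\<And>w. w \<in> convex hull (v' ` D) \<Longrightarrow> b < (a - z) \<bullet> w"
          using separating_hyperplane_closed_point_inset[of "convex hull (v' ` D)" z] \<open>D \<noteq> {}\<close> by auto
        define l where "l = a - z"
        have l: "norm l > 0" using a(1) \<open>z \<notin> convex hull (v' ` D)\<close> by (auto simp: l_def)
        \<comment> \<open>The point of \<open>cball y r\<close> at which the functional given by
          \<open>l\<close> is least.\<close>
        define t where "t = y + (r / norm l) *\<^sub>R (z - a)"
        have "t \<in> S"
          unfolding t_def using S y z a(1) hull K[OF top] by (intro mem_affine_3_minus) auto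
        moreover have "dist y t = r"
          using l r by (simp add: t_def dist_norm l_def norm_minus_commute)
        ultimately obtain v where v: "v \<in> D" "dist v t < r/4"
          using D(3) by force
        have "l \<bullet> z < l \<bullet> v' v"
          using a(2) a(3)[of "v' v"] v(1) hull_inc[of "v' v" "v' ` D"] by (auto simp: l_def)
        moreover have "l \<bullet> t = l \<bullet> y - r * norm l"
        proof -
          have "t = y - (r / norm l) *\<^sub>R l" by (simp add: t_def l_def algebra_simps)
          then show ?thesis
            using l by (simp add: inner_diff_right dot_square_norm power2_eq_square)
        qed
        moreover have "l \<bullet> (v' v - t) \<le> norm l * (r/2)"
        proof -
          have "norm (v' v - t) \<le> r/2"
            using v v'[OF v(1)] dist_triangle3[of "v' v" t v] by (simp add: dist_norm)
          then show ?thesis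
            by (meson mult_left_mono norm_cauchy_schwarz norm_ge_zero order_trans)
        qed
        moreover have "l \<bullet> (y - z) \<le> norm l * (r/2)"
        proof -
          have "norm (y - z) \<le> r/2" using z by (simp add: dist_norm)
          then show ?thesis
            by (meson mult_left_mono norm_cauchy_schwarz norm_ge_zero order_trans)
        qed
        \<comment> \<open>Passing from \<open>t\<close> to \<open>v' v\<close> costs at most
          \<open>r/2\<close> and from \<open>z\<close> to \<open>y\<close> at most
          \<open>r/2\<close>, in units of \<open>norm l\<close>. This uses up the gain
          \<open>r\<close> at \<open>t\<close>, against the strict separation.\<close>
        ultimately show False by (simp add: inner_diff_right algebra_simps)
      qed
      then show "z \<in> K x'" using hull by blast
    qed
  qed
qed

section \<open>The patched map and its fixed point\<close>

theorem theorem3p4: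
  fixes C :: "(real ^ 'n) set"
    and f :: "real ^ 'n \<Rightarrow> real ^ 'n \<Rightarrow> real"
    and K :: "real ^ 'n \<Rightarrow> (real ^ 'n) set"
  assumes "C \<noteq> {}" and "convex C" and "compact C"
    and "\<forall>x\<in>C. f x x = 0"
    and "\<forall>x\<in>C. K x \<subseteq> C"
    and "lsc_map (top_of_set C) (top_of_set C) K"
    and "\<forall>x\<in>C. K x \<noteq> {} \<and> convex (K x)"
    and "closedin (top_of_set C) (fix_points C K)"
    and "\<forall>x\<in>fix_points C K. convex (neg_map C f x)"
    and "lsc_map (subtopology (top_of_set C) (fix_points C K)) (top_of_set C) (neg_map C f)"
    and "\<forall>x \<in> (top_of_set C) frontier_of (fix_points C K). affine hull (K x) = affine hull C"
    and "\<forall>x \<in> (top_of_set C) frontier_of (fix_points C K).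
           openin (top_of_set C) (neg_map C f x)"
  shows "\<exists>x\<in>C. x \<in> K x \<and> (\<forall>y\<in>K x. f x y \<ge> 0)"
proof (rule ccontr)
  assume no_sol: "\<not> ?thesis"
  define F where "F = neg_map C f"
  define P where "P = fix_points C K"
  define B where "B = (top_of_set C) frontier_of P"
  define G where "G x = (if x \<notin> P then K x else if x \<in> B then K x \<inter> F x else F x)" for x
  have FC: "F x \<subseteq> C" for x by (auto simp: F_def neg_map_def)
  have PC: "P \<subseteq> C" by (auto simp: P_def fix_points_def)
  have K: "K x \<noteq> {}" "convex (K x)" "K x \<subseteq> C" if "x \<in> C" for x
    using that assms(5,7) by auto
  \<comment> \<open>The absence of solutions enters here.\<close>
  have KF: "K x \<inter> F x \<noteq> {}" if "x \<in> P" for x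
    using that no_sol K(3)[of x] by (force simp: P_def fix_points_def F_def neg_map_def not_le)
  have lscK: "lsc_map (top_of_set C) euclidean K"
    using lsc_map_into_euclidean[OF assms(6)] K(3) by simp
  have lscF: "lsc_map (subtopology (top_of_set C) P) euclidean F"
    using lsc_map_into_euclidean[OF assms(10)] FC by (simp add: P_def F_def)
  have openK: "openin (top_of_set C) {x\<in>C. K x \<inter> W \<noteq> {}}" if "open W" for W
    using lscK that unfolding lsc_map_iff_openin by simp
  \<comment> \<open>\<open>F\<close> is semicontinuous only on \<open>P\<close>, so its open sets
    are traces on \<open>P\<close> of sets open in \<open>C\<close>.\<close>
  have openF: "\<exists>V. openin (top_of_set C) V \<and> {x\<in>P. F x \<inter> W \<noteq> {}} = V \<inter> P" if "open W" for W
  proof -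
    have "topspace (subtopology (top_of_set C) P) = P" using PC by auto
    then have "openin (subtopology (top_of_set C) P) {x\<in>P. F x \<inter> W \<noteq> {}}"
      using lscF that unfolding lsc_map_iff_openin by simp
    then show ?thesis by (simp only: openin_subtopology)
  qed
  have nbhd: "\<exists>U. openin (top_of_set C) U \<and> x \<in> U \<and> (\<forall>x'\<in>U. G x' \<inter> W \<noteq> {})"
    if x: "x \<in> C" and W: "open W" and y: "y \<in> G x" "y \<in> W" for x W y
  proof -
    consider "x \<notin> P" | "x \<in> P" "x \<notin> B" | "x \<in> P" "x \<in> B" by blast
    then show ?thesis
    proof cases
      case 1
      \<comment> \<open>As \<open>P\<close> is closed, \<open>x\<close> has a neighbourhood off
        \<open>P\<close>, on which \<open>G\<close> is \<open>K\<close>.\<close>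
      have "openin (top_of_set C) ({x\<in>C. K x \<inter> W \<noteq> {}} \<inter> (C - P))"
        using openK[OF W] assms(8) by (intro openin_Int openin_diff) (auto simp: P_def)
      moreover have "x \<in> {x\<in>C. K x \<inter> W \<noteq> {}} \<inter> (C - P)"
        using 1 x y by (auto simp: G_def)
      ultimately show ?thesis
        by (intro exI conjI) (auto simp: G_def)
    next
      case 2
      \<comment> \<open>On this open set \<open>G\<close> is \<open>F\<close>, and the trace problem
        disappears since it lies inside \<open>P\<close>.\<close>
      define I where "I = (top_of_set C) interior_of P"
      have I: "openin (top_of_set C) I" "I \<subseteq> P" "I \<inter> B = {}"
        by (auto simp: I_def B_def frontier_of_def interior_of_subset)
      have "x \<in> I"
        using 2 closure_of_subset[of P "top_of_set C"] PC by (auto simp: I_def B_def frontier_of_def)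
      obtain V where V: "openin (top_of_set C) V" "{x\<in>P. F x \<inter> W \<noteq> {}} = V \<inter> P"
        using openF[OF W] by blast
      have "openin (top_of_set C) (V \<inter> I)" using V I by blast
      moreover have "x \<in> V \<inter> I"
        using \<open>x \<in> I\<close> 2 y V(2) by (auto simp: G_def)
      moreover have "G x' \<inter> W \<noteq> {}" if "x' \<in> V \<inter> I" for x'
        using that V(2) I by (auto simp: G_def)
      ultimately show ?thesis by blast
    next
      case 3
      then have yKF: "y \<in> K x" "y \<in> F x" using y by (auto simp: G_def)
      have "openin (top_of_set C) (F x)"
        using assms(12) 3 by (auto simp: F_def B_def P_def)
      then obtain T where T: "open T" "F x = C \<inter> T" by (auto simp: openin_open)
      \<comment> \<open>\<open>y\<close> may lie on the relative boundary of \<open>K x\<close>. It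
        is replaced by a relative interior point \<open>z\<close> that stays in \<open>T\<close> and
        \<open>W\<close>.\<close>
      have "y \<in> closure (rel_interior (K x))"
        using convex_closure_rel_interior[OF K(2)[OF x]] yKF closure_subset by blast
      then obtain z where z: "z \<in> rel_interior (K x)" "z \<in> T \<inter> W"
        using T yKF y W unfolding closure_iff_nhds_not_empty
        by (metis IntE IntI disjoint_iff open_Int subset_refl)
      have aff: "affine hull K x = affine hull C"
        using assms(11) 3 by (auto simp: B_def P_def)
      obtain r where r: "r > 0" "cball z r \<inter> affine hull C \<subseteq> K x"
        using z(1) aff unfolding mem_rel_interior_cball by auto
      have zC: "z \<in> C" using z(1) K(3)[OF x] rel_interior_subset by blast
      have CS: "C \<subseteq> affine hull C" by (rule hull_subset)
      have KS: "convex (K x') \<and> K x' \<subseteq> affine hull C" if "x' \<in> topspace (top_of_set C)" for x'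
        using K(2,3)[of x'] that CS by auto
      obtain U where U: "openin (top_of_set C) U" "x \<in> U"
        "\<And>x'. x' \<in> U \<Longrightarrow> cball z (r/2) \<inter> affine hull C \<subseteq> K x'"
        using lsc_map_locally_contains_cball[OF lscK KS affine_affine_hull _ _ r] x zC CS
        by auto
      \<comment> \<open>For \<open>x'\<close> in \<open>U\<close>, every point of
        \<open>F x'\<close> in the small ball about \<open>z\<close> lies in \<open>K x'\<close>
        too.\<close>
      define W' where "W' = W \<inter> ball z (r/2)"
      have W': "open W'" using W by (simp add: W'_def open_Int)
      obtain V where V: "openin (top_of_set C) V" "{x\<in>P. F x \<inter> W' \<noteq> {}} = V \<inter> P"
        using openF[OF W'] by blast
      \<comment> \<open>The middle set serves the nearby points off \<open>P\<close>;
        \<open>U\<close> and \<open>V\<close> serve those in \<open>P\<close>, where the point found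
        lies in both \<open>K x'\<close> and \<open>F x'\<close>, whichever clause defines
        \<open>G x'\<close>.\<close>
      have "openin (top_of_set C) (U \<inter> {x\<in>C. K x \<inter> W \<noteq> {}} \<inter> V)"
        using U V openK[OF W] by blast
      moreover have "x \<in> U \<inter> {x\<in>C. K x \<inter> W \<noteq> {}} \<inter> V"
      proof -
        have "z \<in> F x \<inter> W'" using z T zC r by (auto simp: W'_def)
        then have "x \<in> V" using 3 V(2) by blast
        then show ?thesis using U x yKF y by blast
      qed
      moreover have "G x' \<inter> W \<noteq> {}" if x': "x' \<in> U \<inter> {x\<in>C. K x \<inter> W \<noteq> {}} \<inter> V" for x'
      proof (cases "x' \<in> P")
        case False
        then show ?thesis using x' by (auto simp: G_def)
      next
        case True
        then obtain w where w: "w \<in> F x'" "w \<in> W'" using x' V(2) by blast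
        then have "w \<in> K x'"
          using U(3)[of x'] x' FC[of x'] CS by (auto simp: W'_def subset_iff)
        then show ?thesis using w True by (auto simp: G_def W'_def)
      qed
      ultimately show ?thesis by blast
    qed
  qed
  have "lsc_map (top_of_set C) euclidean G"
    unfolding lsc_map_def lsc_map_at_def using nbhd by fastforce
  moreover have "G x \<noteq> {} \<and> convex (G x)" if "x \<in> C" for x
    using K[OF that] KF[of x] assms(9) by (auto simp: G_def F_def P_def convex_Int)
  moreover have GC: "G x \<subseteq> C" if "x \<in> C" for x
    using K(3)[OF that] FC by (auto simp: G_def)
  then have "bounded (\<Union>x\<in>C. G x)"
    using compact_imp_bounded[OF assms(3)] by (rule_tac bounded_subset) auto
  ultimately obtain g where g: "continuous_on C g" "\<And>x. x \<in> C \<Longrightarrow> g x \<in> rel_interior (G x)"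
    using lsc_map_rel_interior_selection[OF assms(3)] by metis
  have gG: "g x \<in> G x" if "x \<in> C" for x
    using g(2)[OF that] rel_interior_subset by blast
  then obtain x where x: "x \<in> C" "g x = x"
    using brouwer[OF assms(3,2,1) g(1)] GC by blast
  then have "x \<in> G x" using gG by force
  then have "x \<in> F x"
    using x(1) by (auto simp: G_def P_def fix_points_def split: if_splits)
  then show False
    using x(1) assms(4) by (simp add: F_def neg_map_def)
qed

end
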